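(* Suppose that $n$ is a positive integer which is exactly divisible by $8$; that is, $n=8N$ where $N$ is an odd positive integer. Then the equation $$x^4+y^4+z^4-2x^2y^2-2y^2z^2-2z^2x^2=n$$ has no integer solutions $(x,y,z)$. *)

theory Defs
  imports Main
begin

end

theory Submission
  imports Defs
begin

text \<open>
  The quartic form is, up to sign, Heron's expression for sixteen times the squared area of a
  triangle with sides \<open>x\<close>, \<open>y\<close>, \<open>z\<close>, so it splits into four linear factors
  \<open>\<plusminus>x \<plusminus> y \<plusminus> z\<close>. Changing a sign alters such a factor by an even number, hence the
  four factors share one parity. If they are odd, so is the product; if they are even, the
  product is divisible by \<open>2\<^sup>4 = 16\<close>. In neither case can 8 divide the value exactly.
\<close>

lemma heron_quartic_factorization:
  fixes x y z :: "'a::comm_ring_1"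
  shows "x^4 + y^4 + z^4 - 2 * x^2 * y^2 - 2 * y^2 * z^2 - 2 * z^2 * x^2
    = (x + y + z) * (x + y - z) * (x - y + z) * (x - y - z)"
  by (simp add: algebra_simps power2_eq_square power4_eq_xxxx)

lemma heron_quartic_odd_or_16_dvd:
  fixes x y z :: int
  defines "q \<equiv> x^4 + y^4 + z^4 - 2 * x^2 * y^2 - 2 * y^2 * z^2 - 2 * z^2 * x^2"
  shows "odd q \<or> 16 dvd q"
proof (cases "even (x + y + z)")
  case True
  then have "even (x + y - z)" "even (x - y + z)" "even (x - y - z)"
    by auto
  with True have "2 * 2 * 2 * 2 dvd (x + y + z) * (x + y - z) * (x - y + z) * (x - y - z)"
    by (intro mult_dvd_mono)
  then show ?thesis
    unfolding q_def heron_quartic_factorization by simp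
next
  case False
  then have "odd (x + y - z)" "odd (x - y + z)" "odd (x - y - z)"
    by auto
  with False show ?thesis
    unfolding q_def heron_quartic_factorization by simp
qed

theorem theorem1:
  fixes n N :: int
  assumes "n > 0" and "n = 8 * N" and "N > 0" and "odd N"
  shows "\<not> (\<exists>x y z :: int.
    x^4 + y^4 + z^4 - 2 * x^2 * y^2 - 2 * y^2 * z^2 - 2 * z^2 * x^2 = n)"
proof -
  have "even n" "\<not> 16 dvd n"
    using \<open>n = 8 * N\<close> \<open>odd N\<close> by presburger+
  then show ?thesis
    using heron_quartic_odd_or_16_dvd by blast
qed

end
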